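(* For all $n\ge1$ and $k\ge3$, $$|\mathcal S_n(132,\,k(k-1)\cdots1)|=\frac1n\sum_{i=1}^{k-1}\binom ni\binom n{i-1}.$$
   Context: $\mathcal S_n(\tau_1,\tau_2)$ is the set of permutations $\pi=\pi_1\cdots\pi_n$ of $\{1,\dots,n\}$ avoiding both patterns $\tau_1$ and $\tau_2$, where $\pi$ avoids $\tau\in\mathcal S_k$ if there are no $i_1<\dots<i_k$ such that $\pi_{i_1}\cdots\pi_{i_k}$ is in the same relative order as $\tau_1\cdots\tau_k$. Here $k(k-1)\cdots1$ is the decreasing permutation of length $k$. *)

theory Defs
  imports Complex_Main "HOL-Combinatorics.Multiset_Permutations"
begin

text \<open>
  Permutations are in one-line notation: the list \<open>[\<pi>\<^sub>1, \<dots>, \<pi>\<^sub>n]\<close>.  List positions are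
  counted from 0, the entries from 1.
\<close>

definition contains_pattern :: "nat list \<Rightarrow> nat list \<Rightarrow> bool" where
  "contains_pattern \<pi> \<tau> \<longleftrightarrow>
     (\<exists>f :: nat \<Rightarrow> nat. strict_mono_on {..<length \<tau>} f \<and>
        f ` {..<length \<tau>} \<subseteq> {..<length \<pi>} \<and>
        (\<forall>a<length \<tau>. \<forall>b<length \<tau>. \<pi> ! f a < \<pi> ! f b \<longleftrightarrow> \<tau> ! a < \<tau> ! b))"

definition avoids :: "nat list \<Rightarrow> nat list \<Rightarrow> bool" where
  "avoids \<pi> \<tau> \<longleftrightarrow> \<not> contains_pattern \<pi> \<tau>"

definition avoiding_perms :: "nat \<Rightarrow> nat list \<Rightarrow> nat list \<Rightarrow> nat list set" where
  "avoiding_perms n \<tau>\<^sub>1 \<tau>\<^sub>2 = {\<pi> \<in> permutations_of_set {1..n}. avoids \<pi> \<tau>\<^sub>1 \<and> avoids \<pi> \<tau>\<^sub>2}"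

definition decreasing_perm :: "nat \<Rightarrow> nat list" where
  "decreasing_perm k = rev [1..<Suc k]"

end

theory Submission
  imports Defs "HOL-Library.Sublist" "HOL-Computational_Algebra.Formal_Power_Series"
    "HOL-Computational_Algebra.Polynomial"
begin

text \<open>
  Avoiding the decreasing pattern of length \<open>k\<close> means that the longest decreasing subsequence is
  shorter than \<open>k\<close>.  So the theorem follows from a refined count: among the 132-avoiding
  permutations of \<open>n \<ge> 1\<close> values, those whose longest decreasing subsequence has length \<open>i \<ge> 1\<close>
  are counted by the Narayana number \<open>(n choose i) * (n choose (i - 1)) / n\<close>.

  A permutation \<open>L @ m # R\<close> with maximum \<open>m\<close> avoids 132 iff \<open>L\<close> and \<open>R\<close> do and every entry of \<open>L\<close>
  exceeds every entry of \<open>R\<close> (\<open>avoids_132_split_max\<close>).  Then the longest decreasing subsequence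
  of the whole is one of \<open>L @ [m]\<close> followed by one of \<open>R\<close> (\<open>lds_split_max\<close>), where \<open>m\<close>
  is needed only if \<open>L\<close> is empty.  Let \<open>F\<close> be the power series in \<open>z\<close> whose \<open>n\<close>-th coefficient is the
  polynomial in \<open>x\<close> recording the lengths of the longest decreasing subsequences.  The decomposition
  becomes \<open>F = 1 + z (F - 1 + x) F\<close> (\<open>lds_poly_fps\<close>).

  Expanding the solution of this quadratic equation directly is awkward.  Instead, its discriminant
  \<open>D\<close> is a polynomial in \<open>z\<close> with the square root \<open>S = 1 - z (x - 1) - 2 z F\<close>, so \<open>S\<close>
  satisfies the linear differential equation \<open>2 D S' = D' S\<close>.  Comparing coefficients gives a
  three-term recurrence for the polynomials (\<open>lds_poly_recurrence\<close>), and the Narayana numbers satisfy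
  the same one (\<open>narayana_recurrence\<close>).
\<close>

section \<open>Patterns as subsequences\<close>

lemma subseq_iff_index_embedding:
  "subseq ys xs \<longleftrightarrow> (\<exists>f. strict_mono_on {..<length ys} f \<and>
     f ` {..<length ys} \<subseteq> {..<length xs} \<and> (\<forall>i<length ys. ys ! i = xs ! f i))"
  (is "_ \<longleftrightarrow> (\<exists>f. ?E ys xs f)")
proof
  assume "subseq ys xs"
  then show "\<exists>f. ?E ys xs f"
  proof (induction rule: list_emb.induct)
    case (list_emb_Nil xs)
    then show ?case by (auto simp: strict_mono_on_def)
  next
    case (list_emb_Cons ys xs x)
    then obtain f where "?E ys xs f" by blast
    then have "?E ys (x # xs) (Suc \<circ> f)" by (auto simp: strict_mono_on_def)
    then show ?case by blast
  next
    case (list_emb_Cons2 y x ys xs)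
    then obtain f where "?E ys xs f" by blast
    then have "?E (y # ys) (x # xs) (case_nat 0 (Suc \<circ> f))"
      using list_emb_Cons2.hyps by (force simp: strict_mono_on_def less_Suc_eq_0_disj split: nat.splits)
    then show ?case by blast
  qed
next
  assume "\<exists>f. ?E ys xs f"
  then obtain f where "?E ys xs f" by blast
  then show "subseq ys xs"
  proof (induction ys arbitrary: xs rule: rev_induct)
    case Nil
    then show ?case by simp
  next
    case (snoc y ys)
    let ?j = "f (length ys)"
    have j: "?j < length xs" and y: "y = xs ! ?j"
      using snoc.prems by (auto simp: nth_append)
    have lt: "f i < ?j" if "i < length ys" for i
      using snoc.prems that by (auto simp: strict_mono_on_def)
    have nth: "ys ! i = xs ! f i" if "i < length ys" for i
      using snoc.prems that by (auto simp: nth_append dest: spec[of _ i])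
    have "?E ys (take ?j xs) f"
      using snoc.prems lt nth j by (auto simp: strict_mono_on_def)
    then have "subseq ys (take ?j xs)" by (rule snoc.IH)
    moreover have "subseq [y] (drop ?j xs)"
      using j y by (simp add: Cons_nth_drop_Suc[symmetric])
    ultimately have "subseq (ys @ [y]) (take ?j xs @ drop ?j xs)"
      by (rule list_emb_append_mono)
    then show ?case by simp
  qed
qed

text \<open>
  Occurrences as subsequences rather than index functions: these can be cut along
  concatenations, which is what the decomposition at the maximum requires.
\<close>

lemma contains_pattern_iff_subseq:
  "contains_pattern \<pi> \<tau> \<longleftrightarrow> (\<exists>ys. subseq ys \<pi> \<and> length ys = length \<tau> \<and>
     (\<forall>a<length \<tau>. \<forall>b<length \<tau>. ys ! a < ys ! b \<longleftrightarrow> \<tau> ! a < \<tau> ! b))"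
proof
  assume "contains_pattern \<pi> \<tau>"
  then obtain f where f: "strict_mono_on {..<length \<tau>} f" "f ` {..<length \<tau>} \<subseteq> {..<length \<pi>}"
    "\<forall>a<length \<tau>. \<forall>b<length \<tau>. \<pi> ! f a < \<pi> ! f b \<longleftrightarrow> \<tau> ! a < \<tau> ! b"
    unfolding contains_pattern_def by blast
  define ys where "ys = map (\<lambda>i. \<pi> ! f i) [0..<length \<tau>]"
  have "subseq ys \<pi>"
    unfolding subseq_iff_index_embedding using f by (intro exI[of _ f]) (auto simp: ys_def)
  with f(3) show "\<exists>ys. subseq ys \<pi> \<and> length ys = length \<tau> \<and>
     (\<forall>a<length \<tau>. \<forall>b<length \<tau>. ys ! a < ys ! b \<longleftrightarrow> \<tau> ! a < \<tau> ! b)"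
    by (intro exI[of _ ys]) (auto simp: ys_def)
next
  assume "\<exists>ys. subseq ys \<pi> \<and> length ys = length \<tau> \<and>
     (\<forall>a<length \<tau>. \<forall>b<length \<tau>. ys ! a < ys ! b \<longleftrightarrow> \<tau> ! a < \<tau> ! b)"
  then obtain ys where ys: "subseq ys \<pi>" "length ys = length \<tau>"
     "\<forall>a<length \<tau>. \<forall>b<length \<tau>. ys ! a < ys ! b \<longleftrightarrow> \<tau> ! a < \<tau> ! b" by blast
  then show "contains_pattern \<pi> \<tau>"
    unfolding contains_pattern_def subseq_iff_index_embedding by auto
qed

definition avoids_132 :: "nat list \<Rightarrow> bool" where
  "avoids_132 \<pi> \<longleftrightarrow> \<not> (\<exists>x y z. subseq [x, z, y] \<pi> \<and> x < y \<and> y < z)"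

lemma avoids_132_iff: "avoids \<pi> [1, 3, 2] \<longleftrightarrow> avoids_132 \<pi>"
proof -
  have less3: "(\<forall>a<Suc (Suc (Suc 0)). P a) \<longleftrightarrow> P 0 \<and> P 1 \<and> P 2" for P
    by (auto simp: less_Suc_eq numeral_2_eq_2)
  have "contains_pattern \<pi> [1, 3, 2] \<longleftrightarrow> (\<exists>x y z. subseq [x, z, y] \<pi> \<and> x < y \<and> y < z)"
  proof
    assume "contains_pattern \<pi> [1, 3, 2]"
    then obtain ys where ys: "subseq ys \<pi>" "length ys = Suc (Suc (Suc 0))"
      "\<forall>a<Suc (Suc (Suc 0)). \<forall>b<Suc (Suc (Suc 0)). ys ! a < ys ! b \<longleftrightarrow> [1,3,2::nat] ! a < [1,3,2] ! b"
      unfolding contains_pattern_iff_subseq by auto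
    obtain x z y where [simp]: "ys = [x, z, y]"
      using ys(2) by (auto simp: length_Suc_conv)
    show "\<exists>x y z. subseq [x, z, y] \<pi> \<and> x < y \<and> y < z"
      using ys(1) ys(3)[unfolded less3] by auto
  next
    assume "\<exists>x y z. subseq [x, z, y] \<pi> \<and> x < y \<and> y < z"
    then obtain x y z where "subseq [x, z, y] \<pi>" "x < y" "y < z" by blast
    then show "contains_pattern \<pi> [1, 3, 2]"
      unfolding contains_pattern_iff_subseq
      by (intro exI[of _ "[x, z, y]"]) (simp add: less3)
  qed
  then show ?thesis by (simp add: avoids_def avoids_132_def)
qed

text \<open>
  The name abbreviates "longest decreasing subsequence".  The empty list is always a candidate, so
  \<open>Max\<close> is taken over a nonempty set.
\<close>

definition lds :: "nat list \<Rightarrow> nat" where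
  "lds xs = Max (length ` {ys. subseq ys xs \<and> sorted_wrt (>) ys})"

lemma finite_decreasing_subseqs: "finite {ys. subseq ys xs \<and> sorted_wrt (>) ys}"
  by (rule finite_subset[OF _ finite_set[of "subseqs xs"]]) auto

lemma lds_ge: "subseq ys xs \<Longrightarrow> sorted_wrt (>) ys \<Longrightarrow> length ys \<le> lds xs"
  unfolding lds_def by (rule Max_ge) (use finite_decreasing_subseqs in auto)

lemma lds_witness: obtains ys where "subseq ys xs" "sorted_wrt (>) ys" "length ys = lds xs"
proof -
  have "[] \<in> {ys. subseq ys xs \<and> sorted_wrt (>) ys}" by simp
  then have "lds xs \<in> length ` {ys. subseq ys xs \<and> sorted_wrt (>) ys}"
    unfolding lds_def using finite_decreasing_subseqs by (intro Max_in) blast+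
  then show ?thesis using that by auto
qed

lemma lds_eqI:
  assumes "subseq ys xs" "sorted_wrt (>) ys" "length ys = l"
    and "\<And>zs. subseq zs xs \<Longrightarrow> sorted_wrt (>) zs \<Longrightarrow> length zs \<le> l"
  shows "lds xs = l"
  using lds_ge[OF assms(1,2)] assms(3,4) lds_witness by (metis order_antisym)

lemma lds_Nil [simp]: "lds [] = 0"
  by (rule lds_eqI[of "[]"]) auto

lemma lds_pos: "xs \<noteq> [] \<Longrightarrow> lds xs > 0"
  using lds_ge[of "[hd xs]" xs] by (cases xs) auto

text \<open>
  A decreasing subsequence longer than \<open>k\<close> can be truncated to length exactly \<open>k\<close>.
\<close>

lemma avoids_decreasing_iff: "avoids \<pi> (decreasing_perm k) \<longleftrightarrow> lds \<pi> < k"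
proof -
  have nth: "decreasing_perm k ! a < decreasing_perm k ! b \<longleftrightarrow> b < a" if "a < k" "b < k" for a b
    using that by (auto simp: decreasing_perm_def rev_nth simp del: upt_Suc)
  have len: "length (decreasing_perm k) = k" by (simp add: decreasing_perm_def)
  have "contains_pattern \<pi> (decreasing_perm k) \<longleftrightarrow>
      (\<exists>ys. subseq ys \<pi> \<and> length ys = k \<and> sorted_wrt (>) ys)"
    unfolding contains_pattern_iff_subseq len
  proof (intro ex_cong1 conj_cong refl)
    fix ys :: "nat list" assume l: "length ys = k"
    show "(\<forall>a<k. \<forall>b<k. ys ! a < ys ! b \<longleftrightarrow> decreasing_perm k ! a < decreasing_perm k ! b)
        \<longleftrightarrow> sorted_wrt (>) ys" (is "?A \<longleftrightarrow> ?B")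
    proof
      assume ?A then show ?B using l nth by (auto simp: sorted_wrt_iff_nth_less)
    next
      assume ?B
      then have "ys ! b < ys ! a" if "a < b" "b < k" for a b
        using that l by (auto simp: sorted_wrt_iff_nth_less)
      then show ?A using nth by (metis linorder_neqE_nat order_less_asym)
    qed
  qed
  also have "\<dots> \<longleftrightarrow> k \<le> lds \<pi>"
  proof
    assume "k \<le> lds \<pi>"
    obtain ys where "subseq ys \<pi>" "sorted_wrt (>) ys" "length ys = lds \<pi>" by (rule lds_witness)
    with \<open>k \<le> lds \<pi>\<close> show "\<exists>ys. subseq ys \<pi> \<and> length ys = k \<and> sorted_wrt (>) ys"
      by (intro exI[of _ "take k ys"])
        (auto intro: subseq_order.trans[OF prefix_imp_subseq] take_is_prefix sorted_wrt_take)
  qed (use lds_ge in auto)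
  finally show ?thesis by (auto simp: avoids_def)
qed

section \<open>Decomposition at the maximum\<close>

lemma set_mono_subseq: "subseq xs ys \<Longrightarrow> set xs \<subseteq> set ys"
  by (auto elim: list_emb_set)

text \<open>
  An entry \<open>x\<close> of \<open>L\<close> below an entry \<open>y\<close> of \<open>R\<close> would give the occurrence \<open>x m y\<close>.  Conversely, an
  occurrence that is not inside \<open>L\<close> or inside \<open>R\<close> must have its "1" in \<open>L\<close> and its "2" in \<open>R\<close>,
  since \<open>m\<close> can only play the part of the "3".
\<close>

lemma avoids_132_split_max:
  assumes "distinct (L @ m # R)" "\<forall>x\<in>set L \<union> set R. x < m"
  shows "avoids_132 (L @ m # R) \<longleftrightarrow>
    avoids_132 L \<and> avoids_132 R \<and> (\<forall>x\<in>set L. \<forall>y\<in>set R. y < x)"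
proof (intro iffI conjI ballI)
  assume av: "avoids_132 (L @ m # R)"
  have "subseq L (L @ m # R)" "subseq R (L @ m # R)"
    by (auto intro: subseq_rev_drop_many list_emb_append2)
  then show "avoids_132 L" "avoids_132 R"
    using av unfolding avoids_132_def by (meson subseq_order.trans)+
  fix x y assume xy: "x \<in> set L" "y \<in> set R"
  have "subseq ([x] @ [m, y]) (L @ m # R)"
    using xy by (intro list_emb_append_mono) (auto simp: subseq_singleton_left)
  then show "y < x"
  proof -
    have "subseq [x, m, y] (L @ m # R)"
      using \<open>subseq ([x] @ [m, y]) (L @ m # R)\<close> by simp
    then have "\<not> x < y" using av xy assms(2) unfolding avoids_132_def by blast
    moreover have "x \<noteq> y" using xy assms(1) by auto
    ultimately show ?thesis by simp
  qed
next
  assume A: "avoids_132 L \<and> avoids_132 R \<and> (\<forall>x\<in>set L. \<forall>y\<in>set R. y < x)"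
  show "avoids_132 (L @ m # R)"
    unfolding avoids_132_def
  proof (intro notI, elim exE conjE)
    fix x y z assume s: "subseq [x, z, y] (L @ m # R)" and xyz: "x < y" "y < z"
    obtain u v where uv: "[x, z, y] = u @ v" "subseq u L" "subseq v (m # R)"
      using s by (rule subseq_appendE)
    have sub: "set u \<subseteq> set L" "set v \<subseteq> insert m (set R)"
      using uv(2,3) by (auto dest!: set_mono_subseq)
    have "z \<le> m" using set_mono_subseq[OF s] assms(2) by (auto simp: less_imp_le)
    then have yz: "y < m" using xyz by simp
    consider "u = [x,z,y]" | "v = [x,z,y]" | "x \<in> set u" "y \<in> set v"
      using uv(1) by (auto simp: Cons_eq_append_conv)
    then show False
    proof cases
      case 1
      then show ?thesis using uv(2) A xyz unfolding avoids_132_def by blast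
    next
      case 2
      have "x \<noteq> m" using xyz yz by simp
      then have "subseq [x,z,y] R" using uv(3) 2 by simp
      then show ?thesis using A xyz unfolding avoids_132_def by blast
    next
      case 3
      then have "x \<in> set L" "y \<in> set R" using sub yz by auto
      then show ?thesis using A xyz by fastforce
    qed
  qed
qed

text \<open>
  Decreasing sequences in \<open>L @ [m]\<close> and in \<open>R\<close> can be concatenated freely.  Inside \<open>L @ [m]\<close> the
  entry \<open>m\<close> comes last and is the largest, so a decreasing sequence using it is just \<open>[m]\<close>; this
  beats the best one in \<open>L\<close> only when \<open>L\<close> is empty, hence \<open>max 1\<close>.
\<close>

lemma lds_split_max:
  assumes "\<forall>x\<in>set L. x < m" "\<forall>x\<in>set L. \<forall>y\<in>set R. y < x" "\<forall>y\<in>set R. y < m"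
  shows "lds (L @ m # R) = max 1 (lds L) + lds R"
proof -
  obtain v where v: "subseq v R" "sorted_wrt (>) v" "length v = lds R" by (rule lds_witness)
  obtain u where u: "subseq u (L @ [m])" "sorted_wrt (>) u" "length u = max 1 (lds L)"
  proof (cases "L = []")
    case True
    then show ?thesis using that[of "[m]"] by simp
  next
    case False
    obtain u where "subseq u L" "sorted_wrt (>) u" "length u = lds L" by (rule lds_witness)
    then show ?thesis using that[of u] lds_pos[OF False] by (auto intro: subseq_rev_drop_many)
  qed
  show ?thesis
  proof (rule lds_eqI)
    show "subseq (u @ v) (L @ m # R)"
      using list_emb_append_mono[OF u(1) v(1)] by simp
    have "set u \<subseteq> insert m (set L)" "set v \<subseteq> set R"
      using u(1) v(1) by (auto dest!: set_mono_subseq)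
    then show "sorted_wrt (>) (u @ v)"
      using u(2) v(2) assms by (auto simp: sorted_wrt_append subset_iff)
    show "length (u @ v) = max 1 (lds L) + lds R" using u(3) v(3) by simp
  next
    fix zs assume zs: "subseq zs (L @ m # R)" "sorted_wrt (>) zs"
    then have "subseq zs ((L @ [m]) @ R)" by simp
    then obtain s t where st: "zs = s @ t" "subseq s (L @ [m])" "subseq t R"
      by (rule subseq_appendE)
    then have "length t \<le> lds R" using zs(2) lds_ge by (auto simp: sorted_wrt_append)
    moreover have "length s \<le> max 1 (lds L)"
    proof -
      obtain p q where pq: "s = p @ q" "subseq p L" "subseq q [m]"
        using st(2) by (rule subseq_appendE)
      have p: "length p \<le> lds L" using pq zs(2) st(1) lds_ge by (auto simp: sorted_wrt_append)
      have "q = [] \<or> q = [m]" using pq(3) by (cases q) (auto split: if_splits)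
      moreover have "p = []" if "q = [m]"
      proof (rule ccontr)
        assume "p \<noteq> []"
        then obtain x where "x \<in> set p" by (cases p) auto
        then have "x < m" "x > m"
          using pq(1,2) st(1) zs(2) that assms(1) by (auto simp: sorted_wrt_append dest!: set_mono_subseq)
        then show False by simp
      qed
      ultimately show ?thesis using pq(1) p by auto
    qed
    ultimately show "length zs \<le> max 1 (lds L) + lds R" using st(1) by simp
  qed
qed

text \<open>
  The left end \<open>a\<close> of the interval of values is kept arbitrary because the two parts of the
  decomposition again use intervals of values; this makes standardization unnecessary.
\<close>

definition perms_132 :: "nat \<Rightarrow> nat \<Rightarrow> nat list set" where
  "perms_132 a n = {\<pi>. set \<pi> = {a..<a + n} \<and> distinct \<pi> \<and> avoids_132 \<pi>}"

lemma finite_perms_132 [simp]: "finite (perms_132 a n)"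
  by (rule finite_subset[OF _ finite_permutations_of_set[of "{a..<a+n}"]])
    (auto simp: perms_132_def permutations_of_set_def)

lemma perms_132_length: "\<pi> \<in> perms_132 a n \<Longrightarrow> length \<pi> = n"
  using distinct_card[of \<pi>] by (simp add: perms_132_def)

lemma interval_split:
  fixes a n :: nat
  assumes "A \<union> B = {a..<a + n}" "\<forall>x\<in>A. \<forall>y\<in>B. y < x"
  shows "\<exists>m\<le>n. A = {a + n - m..<a + n} \<and> B = {a..<a + n - m}"
proof (cases "A = {}")
  case True
  then show ?thesis using assms by (intro exI[of _ 0]) auto
next
  case False
  define c where "c = Min A"
  have fin: "finite A" using assms(1) by (metis finite_Un finite_atLeastLessThan)
  then have c: "c \<in> A" "\<forall>x\<in>A. c \<le> x" using False by (auto simp: c_def)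
  have cr: "a \<le> c" "c < a + n" using c(1) assms(1) by auto
  have "A = {c..<a + n}"
  proof
    show "A \<subseteq> {c..<a + n}" using c assms(1) by auto
    show "{c..<a + n} \<subseteq> A"
    proof
      fix x assume x: "x \<in> {c..<a+n}"
      then have "x \<in> A \<union> B" using cr assms(1) by auto
      moreover have "x \<notin> B" using assms(2) c(1) x by fastforce
      ultimately show "x \<in> A" by simp
    qed
  qed
  moreover have "B = {a..<c}"
  proof
    show "B \<subseteq> {a..<c}" using assms c(1) by auto
    show "{a..<c} \<subseteq> B"
    proof
      fix x assume x: "x \<in> {a..<c}"
      then have "x \<in> A \<union> B" using cr assms(1) by auto
      moreover have "x \<notin> A" using c(2) x by fastforce
      ultimately show "x \<in> B" by simp
    qed
  qed
  ultimately show ?thesis using cr by (intro exI[of _ "a + n - c"]) auto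
qed

text \<open>
  In a 132-avoider of \<open>{a..a + n}\<close>, the \<open>m\<close> entries before the maximum \<open>a + n\<close> are the \<open>m\<close> largest
  of the remaining values.
\<close>

lemma perms_132_Suc:
  "perms_132 a (Suc n) =
    (\<Union>m\<le>n. (\<lambda>(L, R). L @ (a + n) # R) ` (perms_132 (a + (n - m)) m \<times> perms_132 a (n - m)))"
  (is "_ = ?U")
proof
  show "perms_132 a (Suc n) \<subseteq> ?U"
  proof
    fix \<pi> assume "\<pi> \<in> perms_132 a (Suc n)"
    then have \<pi>: "set \<pi> = {a..<a + Suc n}" "distinct \<pi>" "avoids_132 \<pi>"
      by (auto simp: perms_132_def)
    then have "a + n \<in> set \<pi>" by simp
    then obtain L R where LR: "\<pi> = L @ (a + n) # R" by (meson split_list)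
    have notin: "a + n \<notin> set L \<union> set R" using \<pi>(2) LR by auto
    have un: "set L \<union> set R = {a..<a + n}"
    proof -
      have "set L \<union> set R = set \<pi> - {a + n}" using notin LR by auto
      then show ?thesis using \<pi>(1) by auto
    qed
    then have "\<forall>x\<in>set L \<union> set R. x < a + n" by auto
    then have av: "avoids_132 L" "avoids_132 R" and lt: "\<forall>x\<in>set L. \<forall>y\<in>set R. y < x"
      using avoids_132_split_max[of L "a + n" R] \<pi>(2,3) LR by auto
    obtain m where m: "m \<le> n" "set L = {a + n - m..<a + n}" "set R = {a..<a + n - m}"
      using interval_split[OF un lt] by blast
    then have "L \<in> perms_132 (a + (n - m)) m" "R \<in> perms_132 a (n - m)"
      using \<pi>(2) LR av by (auto simp: perms_132_def)
    then show "\<pi> \<in> ?U" using m(1) LR by (intro UN_I[of m]) auto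
  qed
next
  show "?U \<subseteq> perms_132 a (Suc n)"
  proof clarify
    fix m L R assume m: "m \<le> n" and L: "L \<in> perms_132 (a + (n - m)) m" and R: "R \<in> perms_132 a (n - m)"
    have sL: "set L = {a + (n - m)..<a + n}" and sR: "set R = {a..<a + (n - m)}"
      using L R m by (auto simp: perms_132_def)
    have d: "distinct (L @ (a + n) # R)"
      using L R sL sR by (auto simp: perms_132_def)
    have "\<forall>x\<in>set L \<union> set R. x < a + n" unfolding sL sR by auto
    moreover have "\<forall>x\<in>set L. \<forall>y\<in>set R. y < x" unfolding sL sR by auto
    moreover have "avoids_132 L" "avoids_132 R" using L R by (simp_all add: perms_132_def)
    ultimately have "avoids_132 (L @ (a + n) # R)"
      using avoids_132_split_max[OF d] by blast
    moreover have "set (L @ (a + n) # R) = {a..<a + Suc n}"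
      unfolding set_append list.set(2) sL sR using m by auto
    ultimately show "L @ (a + n) # R \<in> perms_132 a (Suc n)"
      using d by (simp add: perms_132_def)
  qed
qed

lemma perms_132_0 [simp]: "perms_132 a 0 = {[]}"
  by (auto simp: perms_132_def avoids_132_def)

section \<open>The generating polynomial\<close>

definition lds_poly :: "nat \<Rightarrow> nat \<Rightarrow> real poly" where
  "lds_poly a n = (\<Sum>\<pi>\<in>perms_132 a n. monom 1 (lds \<pi>))"

lemma coeff_lds_poly: "coeff (lds_poly a n) i = real (card {\<pi> \<in> perms_132 a n. lds \<pi> = i})"
proof -
  have "coeff (lds_poly a n) i = (\<Sum>\<pi>\<in>perms_132 a n. if lds \<pi> = i then 1 else 0)"
    by (simp add: lds_poly_def coeff_sum)
  also have "\<dots> = real (card {\<pi> \<in> perms_132 a n. lds \<pi> = i})"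
    by (simp add: sum.If_cases Int_def)
  finally show ?thesis .
qed

lemma lds_poly_0: "lds_poly a 0 = 1"
  by (simp add: lds_poly_def)

text \<open>
  Weights multiply under \<open>L @ m # R\<close> except that an empty \<open>L\<close> has \<open>max 1 (lds L) = 1\<close>; this is
  why the factor for \<open>m = 0\<close> is the indeterminate and not the polynomial of the empty permutation.
\<close>

lemma lds_poly_Suc_shift:
  "lds_poly a (Suc n) =
    (\<Sum>m\<le>n. (if m = 0 then monom 1 1 else lds_poly (a + (n - m)) m) * lds_poly a (n - m))"
proof -
  let ?j = "\<lambda>(L, R). L @ (a + n) # R"
  let ?D = "\<lambda>m. perms_132 (a + (n - m)) m \<times> perms_132 a (n - m)"
  have inj: "inj_on ?j (?D m)" for m
  proof (rule inj_onI, clarify)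
    fix L R L' R'
    assume "L \<in> perms_132 (a + (n - m)) m" "L' \<in> perms_132 (a + (n - m)) m"
      and eq: "L @ (a + n) # R = L' @ (a + n) # R'"
    then have "length L = length L'" by (simp add: perms_132_length)
    with eq show "L = L' \<and> R = R'" by simp
  qed
  have disj: "?j ` ?D m \<inter> ?j ` ?D m' = {}" if "m \<noteq> m'" "m \<le> n" "m' \<le> n" for m m'
  proof -
    have "L @ (a + n) # R \<noteq> L' @ (a + n) # R'"
      if "(L, R) \<in> ?D m" "(L', R') \<in> ?D m'" for L R L' R'
    proof
      assume eq: "L @ (a + n) # R = L' @ (a + n) # R'"
      have "a + n \<notin> set L" "a + n \<notin> set R"
        using that \<open>m \<le> n\<close> by (auto simp: perms_132_def)
      with eq have "L = L'" by (simp add: append_Cons_eq_iff)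
      then show False using that \<open>m \<noteq> m'\<close> by (auto dest: perms_132_length)
    qed
    note neq = this
    show ?thesis
    proof (rule equals0I, elim IntE imageE)
      fix \<pi> p q assume "\<pi> = ?j p" "p \<in> ?D m" "\<pi> = ?j q" "q \<in> ?D m'"
      then show False
        using neq[of "fst p" "snd p" "fst q" "snd q"] by (simp add: case_prod_beta del: mem_Sigma_iff)
    qed
  qed
  have "lds_poly a (Suc n) = (\<Sum>m\<le>n. \<Sum>\<pi>\<in>?j ` ?D m. monom 1 (lds \<pi>))"
    unfolding lds_poly_def perms_132_Suc using disj by (intro sum.UNION_disjoint) auto
  also have "\<dots> = (\<Sum>m\<le>n. (if m = 0 then monom 1 1 else lds_poly (a + (n - m)) m) * lds_poly a (n - m))"
  proof (rule sum.cong[OF refl])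
    fix m assume "m \<in> {..n}"
    then have m: "m \<le> n" by simp
    have w: "monom (1::real) (lds (L @ (a + n) # R)) = monom 1 (max 1 (lds L)) * monom 1 (lds R)"
      if "L \<in> perms_132 (a + (n - m)) m" "R \<in> perms_132 a (n - m)" for L R
    proof -
      have "lds (L @ (a + n) # R) = max 1 (lds L) + lds R"
        using that m by (intro lds_split_max) (auto simp: perms_132_def)
      then show ?thesis by (simp add: mult_monom)
    qed
    have "(\<Sum>\<pi>\<in>?j ` ?D m. monom (1::real) (lds \<pi>)) = (\<Sum>p\<in>?D m. monom 1 (lds (?j p)))"
      by (rule sum.reindex_cong[OF inj]) auto
    also have "\<dots> = (\<Sum>(L, R)\<in>?D m. monom 1 (max 1 (lds L)) * monom 1 (lds R))"
      using w by (intro sum.cong) auto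
    also have "\<dots> = (\<Sum>L\<in>perms_132 (a + (n - m)) m. monom 1 (max 1 (lds L))) * lds_poly a (n - m)"
      by (simp add: sum_product sum.cartesian_product lds_poly_def)
    also have "(\<Sum>L\<in>perms_132 (a + (n - m)) m. monom (1::real) (max 1 (lds L))) =
        (if m = 0 then monom 1 1 else lds_poly (a + (n - m)) m)"
    proof (cases "m = 0")
      case False
      have "max 1 (lds L) = lds L" if "L \<in> perms_132 (a + (n - m)) m" for L
        using lds_pos[of L] perms_132_length[OF that] False by auto
      then show ?thesis using False by (simp add: lds_poly_def)
    qed simp
    finally show "(\<Sum>\<pi>\<in>?j ` ?D m. monom (1::real) (lds \<pi>)) =
      (if m = 0 then monom 1 1 else lds_poly (a + (n - m)) m) * lds_poly a (n - m)" .
  qed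
  finally show ?thesis .
qed

lemma lds_poly_shift: "lds_poly a n = lds_poly 0 n"
proof (induction n arbitrary: a rule: less_induct)
  case (less n)
  show ?case
  proof (cases n)
    case 0
    then show ?thesis by (simp add: lds_poly_0)
  next
    case (Suc l)
    have shift: "lds_poly c m = lds_poly 0 m" if "m \<le> l" for c m
      using less[of m c] that Suc by simp
    have "lds_poly b n =
      (\<Sum>m\<le>l. (if m = 0 then monom 1 1 else lds_poly 0 m) * lds_poly 0 (l - m))" for b
      unfolding Suc lds_poly_Suc_shift
    proof (rule sum.cong[OF refl])
      fix m assume "m \<in> {..l}"
      then have "lds_poly (b + (l - m)) m = lds_poly 0 m" "lds_poly b (l - m) = lds_poly 0 (l - m)"
        by (auto intro: shift)
      then show "(if m = 0 then monom 1 1 else lds_poly (b + (l - m)) m) * lds_poly b (l - m) =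
          (if m = 0 then monom 1 1 else lds_poly 0 m) * lds_poly 0 (l - m)"
        by (simp only:)
    qed
    then show ?thesis by simp
  qed
qed

abbreviation avoider_poly :: "nat \<Rightarrow> real poly" where "avoider_poly \<equiv> lds_poly 0"

lemma avoider_poly_Suc:
  "avoider_poly (Suc n) =
    (\<Sum>m\<le>n. (if m = 0 then [:0, 1:] else avoider_poly m) * avoider_poly (n - m))"
  unfolding lds_poly_Suc_shift
  by (intro sum.cong refl arg_cong2[of _ _ _ _ "(*)"])
    (auto simp: lds_poly_shift[of "n - _"] monom_altdef)

lemma lds_poly_fps:
  defines "F \<equiv> Abs_fps avoider_poly" and "x \<equiv> fps_const [:0, 1:]"
  shows "F = 1 + fps_X * (F - 1 + x) * F"
proof (rule fps_ext)
  fix n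
  show "fps_nth F n = fps_nth (1 + fps_X * (F - 1 + x) * F) n"
  proof (cases n)
    case 0
    then show ?thesis by (simp add: F_def lds_poly_0 mult.assoc)
  next
    case (Suc l)
    have nth: "fps_nth (F - 1 + x) m = (if m = 0 then [:0, 1:] else avoider_poly m)" for m
      by (simp add: F_def x_def lds_poly_0)
    have "fps_nth (1 + fps_X * (F - 1 + x) * F) n = fps_nth ((F - 1 + x) * F) l"
      by (simp add: Suc mult.assoc)
    also have "\<dots> = avoider_poly n"
      unfolding fps_mult_nth nth Suc avoider_poly_Suc atLeast0AtMost by (simp add: F_def)
    finally show ?thesis by (simp add: F_def)
  qed
qed

section \<open>The three-term recurrence\<close>

text \<open>
  Completing the square in the quadratic equation for \<open>F\<close> gives \<open>S\<^sup>2 = D\<close> with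
  \<open>S = 1 - z (x - 1) - 2 z F\<close> and \<open>D = 1 - 2 A z + B z\<^sup>2\<close>.  Then \<open>2 D S' = 2 S\<^sup>2 S' = D' S\<close>
  holds in any commutative ring, so neither an inverse of \<open>D\<close> nor a square root has to be
  constructed.  The recurrence is the coefficient of \<open>z^(n + 2)\<close> in half of this equation.
\<close>

lemma lds_poly_recurrence:
  fixes n :: nat
  defines "A \<equiv> [:1, 1:]" and "B \<equiv> [:-1, 1:] ^ 2"
  shows "of_nat (n + 3) * avoider_poly (n + 2) =
    of_nat (2 * n + 3) * (A * avoider_poly (n + 1)) - of_nat n * (B * avoider_poly n)"
proof -
  define F where "F = Abs_fps avoider_poly"
  define x where "x = fps_const [:0, 1::real:]"
  define a where "a = fps_const A"
  define b where "b = fps_const B"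
  let ?z = "fps_X :: real poly fps"
  have F: "F = 1 + ?z * (F - 1 + x) * F"
    unfolding F_def x_def by (rule lds_poly_fps)
  have a: "a = x + 1"
    by (rule fps_ext) (simp add: a_def A_def x_def one_pCons)
  have "x - 1 = fps_const [:-1, 1:]"
    by (rule fps_ext) (simp add: x_def one_pCons)
  then have b: "b = (x - 1)\<^sup>2"
    by (simp only: b_def B_def fps_const_power)
  define S where "S = 1 - ?z * (x - 1) - 2 * ?z * F"
  define D where "D = 1 - 2 * a * ?z + b * ?z\<^sup>2"
  have S2: "S * S = D" unfolding S_def D_def a b using F by algebra
  have "fps_deriv D = 2 * (b * ?z - a) + fps_deriv b * ?z * ?z - 2 * fps_deriv a * ?z"
    unfolding D_def by (simp add: power2_eq_square algebra_simps)
  moreover have "fps_deriv a = 0" "fps_deriv b = 0" unfolding a_def b_def by simp_all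
  ultimately have dD: "fps_deriv D = 2 * (b * ?z - a)" by (simp only: mult_zero_left mult_zero_right) simp
  have "fps_deriv D = 2 * (S * fps_deriv S)"
    unfolding S2[symmetric] by simp
  then have "2 * (D * fps_deriv S) = fps_deriv D * S"
    by (simp add: S2[symmetric] mult_ac)
  then have "2 * (D * fps_deriv S) = 2 * ((b * ?z - a) * S)"
    unfolding dD by (simp only: mult.assoc)
  then have ode: "D * fps_deriv S = (b * ?z - a) * S"
    by (simp only: mult_cancel_left) simp
  have S_nth: "fps_nth S (Suc (Suc m)) = - 2 * avoider_poly (Suc m)" for m
  proof -
    define G where "G = F + F"
    have "S = 1 - ?z * (x - 1) - ?z * G"
      unfolding S_def G_def by (simp only: mult_2 distrib_left distrib_right)
    moreover have "fps_nth G k = 2 * avoider_poly k" for k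
      by (simp only: G_def F_def fps_add_nth fps_nth_Abs_fps mult_2)
    ultimately show ?thesis by (simp add: x_def)
  qed
  define d where "d = fps_deriv S"
  \<comment> \<open>Writing \<open>2 A\<close> as a constant series makes multiplication by it act coefficientwise.\<close>
  define e where "e = fps_const (A + A)"
  have "e = a + a" by (simp only: e_def a_def fps_const_add)
  then have "d - ?z * (e * d) + ?z * (?z * (b * d)) = ?z * (b * S) - a * S"
    using ode unfolding D_def d_def[symmetric] by algebra
  from arg_cong[OF this, of "\<lambda>f. fps_nth f (Suc (Suc n))"]
  have "fps_nth d (n + 2) - (A + A) * fps_nth d (n + 1) + B * fps_nth d n =
      B * fps_nth S (n + 1) - A * fps_nth S (n + 2)"
    by (simp add: a_def b_def e_def)
  moreover have "fps_nth d (n + 2) = of_nat (n + 3) * (- 2 * avoider_poly (n + 2))"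
    "fps_nth d (n + 1) = of_nat (n + 2) * (- 2 * avoider_poly (n + 1))"
    "fps_nth S (n + 2) = - 2 * avoider_poly (n + 1)"
    using S_nth[of "n + 1"] S_nth[of n] by (simp_all add: d_def numeral_3_eq_3)
  moreover have "fps_nth d n = of_nat (n + 1) * fps_nth S (n + 1)"
    by (simp add: d_def)
  \<comment> \<open>The coefficient of \<open>z\<close> in \<open>S\<close> also involves \<open>x - 1\<close>, but for \<open>n = 0\<close> the factor \<open>n\<close> removes it.\<close>
  moreover have "of_nat n * fps_nth S (n + 1) = of_nat n * (- 2 * avoider_poly n)"
    using S_nth[of "n - 1"] by (cases n) auto
  ultimately have "2 * (of_nat (n + 3) * avoider_poly (n + 2)) =
      2 * (of_nat (2 * n + 3) * (A * avoider_poly (n + 1)) - of_nat n * (B * avoider_poly n))"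
    unfolding of_nat_add of_nat_mult of_nat_numeral of_nat_1 by algebra
  then show ?thesis by (simp only: mult_cancel_left) simp
qed

section \<open>Narayana numbers\<close>

definition narayana :: "nat \<Rightarrow> nat \<Rightarrow> real" where
  "narayana n i = (if i = 0 then 0 else real (n choose i) * real (n choose (i - 1)) / real n)"

text \<open>
  Consecutive binomial coefficients are polynomial multiples of one number, namely
  \<open>t = n! / ((i + 2)! (n + 1 - i)!)\<close> when \<open>i \<le> n + 1\<close>.  Writing them in terms of \<open>t\<close> turns
  identities between their products into polynomial identities in \<open>n\<close>, \<open>i\<close> and \<open>t\<close>, valid without
  case distinctions at the ends of the row.  For \<open>i = 0\<close> the coefficient at \<open>i - 1\<close> is read as 0.
\<close>

lemma binomial_window:
  obtains t :: real where
    "(if i = 0 then 0 else real (n choose (i - 1))) = real i * (real i + 1) * (real i + 2) * t"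
    "real (n choose i) = (real n + 1 - real i) * (real i + 1) * (real i + 2) * t"
    "real (n choose (i + 1)) = (real n + 1 - real i) * (real n - real i) * (real i + 2) * t"
    "real (n choose (i + 2)) = (real n + 1 - real i) * (real n - real i) * (real n - 1 - real i) * t"
proof -
  have step: "real (n choose Suc j) = (real n - real j) * real (n choose j) / (real j + 1)" for j
  proof (cases "j \<le> n")
    case True
    have "Suc j * (n choose Suc j) = (n - j) * (n choose j)"
      by (metis binomial_absorb_comp binomial_absorption)
    then have "real (Suc j) * real (n choose Suc j) = (real n - real j) * real (n choose j)"
      using True by (metis of_nat_diff of_nat_mult)
    then show ?thesis by (simp add: field_simps)
  qed (simp add: binomial_eq_0)
  show ?thesis
  proof (cases i)
    case 0
    have c2: "real (n choose Suc (Suc 0)) = real n * (real n - 1) / 2"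
      using step[of 1] by simp
    show ?thesis
      by (rule that[of "1 / (2 * (real n + 1))"])
        (simp_all add: 0 c2 divide_simps, simp_all add: algebra_simps)
  next
    case (Suc j)
    show ?thesis
      by (rule that[of "real (n choose j) / ((real j + 1) * (real j + 2) * (real j + 3))"])
        (simp_all add: Suc step[of j] step[of "Suc j"] step[of "Suc (Suc j)"] divide_simps,
          simp_all add: algebra_simps)
  qed
qed

lemma narayana_Suc:
  "narayana (Suc n) (Suc i) = real (Suc n choose Suc i) * real (Suc n choose i) / (real n + 1)"
  by (simp add: narayana_def del: binomial_Suc_Suc)

text \<open>
  The coefficientwise form of \<open>lds_poly_recurrence\<close>.  Pascal's rule expresses rows \<open>n + 1\<close> and
  \<open>n + 2\<close> through the same \<open>t\<close>; the sums factor, and their factors \<open>n + 1\<close> and \<open>n + 2\<close>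
  cancel the denominators of the Narayana numbers.
\<close>

lemma narayana_recurrence:
  "real (n + 3) * narayana (n + 2) (i + 2) =
    real (2 * n + 3) * (narayana (n + 1) (i + 2) + narayana (n + 1) (i + 1))
    - real n * (narayana n (i + 2) - 2 * narayana n (i + 1) + narayana n i)"
proof -
  obtain t :: real where t:
    "(if i = 0 then 0 else real (n choose (i - 1))) = real i * (real i + 1) * (real i + 2) * t"
    "real (n choose i) = (real n + 1 - real i) * (real i + 1) * (real i + 2) * t"
    "real (n choose (i + 1)) = (real n + 1 - real i) * (real n - real i) * (real i + 2) * t"
    "real (n choose (i + 2)) = (real n + 1 - real i) * (real n - real i) * (real n - 1 - real i) * t"
    by (rule binomial_window)
  define N where "N = real n"
  define y where "y = real i"
  note t' = t[folded N_def y_def]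
  have c1: "real (Suc n choose i) = (N + 1) * (y + 1) * (y + 2) * t"
  proof -
    have "real (Suc n choose i) = (if i = 0 then 0 else real (n choose (i - 1))) + real (n choose i)"
      by (cases i) auto
    then show ?thesis using t' by (simp add: algebra_simps)
  qed
  have c2: "real (Suc n choose Suc i) = (N + 1) * (N + 1 - y) * (y + 2) * t"
    using t' by (simp add: algebra_simps)
  have c3: "real (Suc n choose Suc (Suc i)) = (N + 1) * (N + 1 - y) * (N - y) * t"
    using t' by (simp add: algebra_simps)
  have c4: "real (Suc (Suc n) choose Suc i) = (N + 1) * (N + 2) * (y + 2) * t"
    using c1 c2 by (simp add: algebra_simps)
  have c5: "real (Suc (Suc n) choose Suc (Suc i)) = (N + 1) * (N + 2) * (N + 1 - y) * t"
    using c2 c3 by (simp add: algebra_simps)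
  have N: "N \<ge> 0" by (simp add: N_def)
  have n2: "narayana (n + 2) (i + 2) = (N + 2) * (N + 1)\<^sup>2 * (N + 1 - y) * (y + 2) * t\<^sup>2"
  proof -
    have "narayana (n + 2) (i + 2) =
        real (Suc (Suc n) choose Suc (Suc i)) * real (Suc (Suc n) choose Suc i) / (N + 2)"
      using narayana_Suc[of "Suc n" "Suc i"] by (simp add: N_def del: binomial_Suc_Suc)
    then show ?thesis
      unfolding c4 c5 using N by (simp add: power2_eq_square mult_ac)
  qed
  have n1: "narayana (n + 1) (i + 2) = (N + 1) * (N + 1 - y)\<^sup>2 * (N - y) * (y + 2) * t\<^sup>2"
    "narayana (n + 1) (i + 1) = (N + 1) * (N + 1 - y) * (y + 1) * (y + 2)\<^sup>2 * t\<^sup>2"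
  proof -
    have "narayana (n + 1) (i + 2) = real (Suc n choose Suc (Suc i)) * real (Suc n choose Suc i) / (N + 1)"
      "narayana (n + 1) (i + 1) = real (Suc n choose Suc i) * real (Suc n choose i) / (N + 1)"
      using narayana_Suc[of n "Suc i"] narayana_Suc[of n i] by (simp_all add: N_def del: binomial_Suc_Suc)
    then show "narayana (n + 1) (i + 2) = (N + 1) * (N + 1 - y)\<^sup>2 * (N - y) * (y + 2) * t\<^sup>2"
      "narayana (n + 1) (i + 1) = (N + 1) * (N + 1 - y) * (y + 1) * (y + 2)\<^sup>2 * t\<^sup>2"
      unfolding c1 c2 c3 using N by (simp_all add: power2_eq_square mult_ac)
  qed
  have mult: "real n * narayana n (Suc j) = real (n choose Suc j) * real (n choose j)" for j
    by (cases n) (simp_all add: narayana_def)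
  have n0: "real n * narayana n (i + 2) = (N + 1 - y)\<^sup>2 * (N - y)\<^sup>2 * (N - 1 - y) * (y + 2) * t\<^sup>2"
    "real n * narayana n (i + 1) = (N + 1 - y)\<^sup>2 * (N - y) * (y + 1) * (y + 2)\<^sup>2 * t\<^sup>2"
    using mult[of "Suc i"] mult[of i] t' by (simp_all add: power2_eq_square)
  have n0': "real n * narayana n i = (N + 1 - y) * y * (y + 1)\<^sup>2 * (y + 2)\<^sup>2 * t\<^sup>2"
  proof (cases i)
    case 0
    then show ?thesis by (simp add: narayana_def y_def)
  next
    case (Suc j)
    then show ?thesis using mult[of j] t' by (simp add: power2_eq_square)
  qed
  have "(N + 3) * ((N + 2) * (N + 1)\<^sup>2 * (N + 1 - y) * (y + 2) * t\<^sup>2) =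
    (2 * N + 3) * ((N + 1) * (N + 1 - y)\<^sup>2 * (N - y) * (y + 2) * t\<^sup>2
       + (N + 1) * (N + 1 - y) * (y + 1) * (y + 2)\<^sup>2 * t\<^sup>2)
    - ((N + 1 - y)\<^sup>2 * (N - y)\<^sup>2 * (N - 1 - y) * (y + 2) * t\<^sup>2
       - 2 * ((N + 1 - y)\<^sup>2 * (N - y) * (y + 1) * (y + 2)\<^sup>2 * t\<^sup>2)
       + (N + 1 - y) * y * (y + 1)\<^sup>2 * (y + 2)\<^sup>2 * t\<^sup>2)"
    by algebra
  moreover have "real n * (narayana n (i + 2) - 2 * narayana n (i + 1) + narayana n i) =
    real n * narayana n (i + 2) - 2 * (real n * narayana n (i + 1)) + real n * narayana n i"
    by (simp add: algebra_simps)
  moreover have "real (n + 3) = N + 3" "real (2 * n + 3) = 2 * N + 3" by (simp_all add: N_def)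
  ultimately show ?thesis using n2 n1 n0 n0' by simp
qed

lemma narayana_low: "narayana n 0 = 0" "n \<ge> 1 \<Longrightarrow> narayana n (Suc 0) = 1"
  by (simp_all add: narayana_def)

text \<open>
  The refined enumeration.  The recurrence determines the polynomials for \<open>n \<ge> 2\<close> from the one for
  \<open>n = 1\<close>, since its term with index \<open>n - 2\<close> vanishes when \<open>n = 2\<close>.
\<close>

theorem coeff_lds_poly_eq_narayana:
  "n \<ge> 1 \<Longrightarrow> coeff (avoider_poly n) i = narayana n i"
proof (induction n arbitrary: i rule: less_induct)
  case (less n)
  have "n = 1 \<or> n \<ge> 2" using less.prems by auto
  then show ?case
  proof
    assume n: "n = 1"
    have "avoider_poly 1 = [:0, 1:]" using avoider_poly_Suc[of 0] by (simp add: lds_poly_0)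
    then show ?thesis
      using n by (cases i; cases "i - 1") (auto simp: narayana_def coeff_pCons)
  next
    assume "n \<ge> 2"
    then obtain m where m: "n = m + 2" by (metis add.commute le_Suc_ex)
    have IH1: "coeff (avoider_poly (m + 1)) j = narayana (m + 1) j" for j
      by (rule less.IH) (auto simp: m)
    \<comment> \<open>The factor \<open>m\<close> covers \<open>m = 0\<close>, where the polynomial is 1 but the Narayana numbers are 0.\<close>
    have IH0: "real m * coeff (avoider_poly m) j = real m * narayana m j" for j
      using less.IH[of m j] by (cases "m = 0") (auto simp: m)
    have coeff_of_nat_mult: "coeff (of_nat a * p) j = real a * coeff p j" for a j and p :: "real poly"
      by (simp add: of_nat_poly)
    have B: "[:-1, 1:] ^ 2 * p = [:1, -2, 1::real:] * p" for p
      by (simp add: power2_eq_square)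
    have rec: "real (m + 3) * coeff (avoider_poly n) j =
        real (2 * m + 3) * coeff ([:1, 1:] * avoider_poly (m + 1)) j
        - real m * coeff ([:1, -2, 1:] * avoider_poly m) j" for j
      using arg_cong[OF lds_poly_recurrence[of m], of "\<lambda>p. coeff p j"]
      unfolding coeff_diff coeff_of_nat_mult B m .
    have "real (m + 3) * coeff (avoider_poly n) i = real (m + 3) * narayana n i"
    proof -
      consider "i = 0" | "i = 1" | j where "i = j + 2"
        by (metis One_nat_def add_2_eq_Suc' not0_implies_Suc)
      then show ?thesis
      proof cases
        case 1
        show ?thesis
          unfolding rec 1 using IH1[of 0] IH0[of 0] by (simp add: narayana_low)
      next
        case 2
        show ?thesis
          unfolding rec 2 using IH1[of 0] IH0[of 0] IH1[of 1] IH0[of 1] m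
          by (cases "m = 0") (simp_all add: narayana_low)
      next
        case (3 j)
        have "real m * coeff ([:1, -2, 1:] * avoider_poly m) (j + 2) =
            real m * coeff (avoider_poly m) (j + 2)
              - 2 * (real m * coeff (avoider_poly m) (j + 1)) + real m * coeff (avoider_poly m) j"
          by (simp add: algebra_simps)
        also have "\<dots> = real m * (narayana m (j + 2) - 2 * narayana m (j + 1) + narayana m j)"
          unfolding IH0 by (simp add: algebra_simps)
        finally show ?thesis
          unfolding 3 rec unfolding m narayana_recurrence[of m j]
          using IH1[of "j + 2"] IH1[of "j + 1"] by simp
      qed
    qed
    then show ?thesis by simp
  qed
qed

theorem corollary4p3:
  fixes n k :: nat
  assumes "n \<ge> 1" and "k \<ge> 3"
  shows "real (card (avoiding_perms n [1, 3, 2] (decreasing_perm k))) =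
    1 / real n * (\<Sum>i = 1..k - 1. real (n choose i) * real (n choose (i - 1)))"
proof -
  have "{1..n} = {1..<1 + n}" by auto
  then have "avoiding_perms n [1, 3, 2] (decreasing_perm k) = {\<pi> \<in> perms_132 1 n. lds \<pi> < k}"
    unfolding avoiding_perms_def avoids_132_iff avoids_decreasing_iff
    by (auto simp: permutations_of_set_def perms_132_def)
  also have "\<dots> = (\<Union>i<k. {\<pi> \<in> perms_132 1 n. lds \<pi> = i})" by auto
  also have "card \<dots> = (\<Sum>i<k. card {\<pi> \<in> perms_132 1 n. lds \<pi> = i})"
    by (rule card_UN_disjoint) auto
  finally have "real (card (avoiding_perms n [1, 3, 2] (decreasing_perm k))) =
      (\<Sum>i<k. narayana n i)"
    by (simp only: of_nat_sum coeff_lds_poly[symmetric] lds_poly_shift[of 1]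
        coeff_lds_poly_eq_narayana[OF assms(1)])
  also have "\<dots> = (\<Sum>i = 1..k - 1. narayana n i)"
    using assms(2) by (intro sum.mono_neutral_right) (auto simp: narayana_low Suc_le_eq not_less_eq_eq)
  also have "\<dots> = 1 / real n * (\<Sum>i = 1..k - 1. real (n choose i) * real (n choose (i - 1)))"
    unfolding sum_distrib_left by (intro sum.cong) (auto simp: narayana_def)
  finally show ?thesis .
qed

end
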